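(* Let $\Gamma=PSL_2(\mathbb Z)$ and let $I_H,I_V,I_D$ be the left ideals of $\mathbb Z[\Gamma^2]$ generated respectively by $$I_H:\ (1+S,1),\ (1+U+U^2,1),\ (1,1-T);$$ $$I_V:\ (1,1+S),\ (1,1+U+U^2),\ (1-US,1);$$ $$I_D:\ (1,1)+(S,S),\ (1,1)+(U,U)+(U^2,U^2).$$ Then the left ideal $\mathcal I_2=I_H\cap I_V\cap I_D$ of $\mathbb Z[\Gamma^2]$ is generated by the five elements $$(1+S,1+S),\qquad (1+U+U^2,1)\big((1,1)+(S,S)\big),\qquad (1,1+U+U^2)\big((1,1)+(S,S)\big),$$ $$(1+U+U^2,1+U+U^2),\qquad (S,S)+(S,US)+(US,US)+(1,U)-(U^2,U^2).$$
   Context: In $\Gamma=PSL_2(\mathbb Z)$: $S=\begin{pmatrix}0&-1\\1&0\end{pmatrix}$, $U=\begin{pmatrix}0&1\\-1&1\end{pmatrix}$, $T=\begin{pmatrix}1&1\\0&1\end{pmatrix}=U^2S$, $US=\begin{pmatrix}1&0\\1&1\end{pmatrix}$. For $x,y\in\mathbb Z[\Gamma]$, $(x,y)$ denotes the element of $\mathbb Z[\Gamma^2]$ obtained by bilinear extension of $(\gamma_1,\gamma_2)\in\Gamma^2$ (i.e. $x\otimes y$ under $\mathbb Z[\Gamma^2]=\mathbb Z[\Gamma]\otimes\mathbb Z[\Gamma]$). *)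

theory Defs
  imports "HOL-Analysis.Analysis" "HOL-Library.Poly_Mapping"
begin

definition psl_eq :: "int^2^2 \<Rightarrow> int^2^2 \<Rightarrow> bool" where
  "psl_eq A B \<longleftrightarrow> det A = 1 \<and> det B = 1 \<and> (A = B \<or> A = - B)"

lemma vec2_2_eq_iff:
  fixes A B :: "int^2^2"
  shows "A = B \<longleftrightarrow> A$1$1 = B$1$1 \<and> A$1$2 = B$1$2 \<and> A$2$1 = B$2$1 \<and> A$2$2 = B$2$2"
  by (auto simp: vec_eq_iff forall_2)

lemma det_uminus_2: "det (- A) = det A" for A :: "int^2^2"
  by (simp add: det_2)

text \<open>The relation is partial: its domain is the set of integer matrices of determinant 1.\<close>

quotient_type psl2z = "int^2^2" / partial: psl_eq
proof (rule part_equivpI)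
  show "\<exists>A. psl_eq A A"
    by (rule exI[of _ "mat 1"]) (simp add: psl_eq_def)
  show "symp psl_eq"
    by (auto simp: symp_def psl_eq_def)
  show "transp psl_eq"
    by (auto simp: transp_def psl_eq_def)
qed

definition adj2 :: "int^2^2 \<Rightarrow> int^2^2" where
  "adj2 A = vector [vector [A$2$2, - A$1$2], vector [- A$2$1, A$1$1]]"

lemma adj2_mult: "det A = 1 \<Longrightarrow> adj2 A ** A = mat 1"
  by (simp add: adj2_def vec2_2_eq_iff matrix_matrix_mult_def sum_2 mat_def det_2 algebra_simps)

lemma psl_eq_mult:
  assumes "psl_eq A B" "psl_eq C D"
  shows "psl_eq (A ** C) (B ** D)"
proof -
  have "- X ** Y = - (X ** Y)" "X ** - Y = - (X ** Y)" for X Y :: "int^2^2"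
    by (simp_all add: vec2_2_eq_iff matrix_matrix_mult_def sum_2)
  with assms show ?thesis
    by (auto simp: psl_eq_def det_mul det_uminus_2)
qed

lemma psl_eq_adj2:
  assumes "psl_eq A B"
  shows "psl_eq (adj2 A) (adj2 B)"
  using assms by (auto simp: psl_eq_def adj2_def det_2 vec2_2_eq_iff algebra_simps)

text \<open>
  The group law is written additively because the convolution product on
  \<open>'a \<Rightarrow>\<^sub>0 'b\<close> is defined for an index type of class \<^class>\<open>monoid_add\<close>;
  \<^class>\<open>group_add\<close> does not assume commutativity. So \<open>x + y\<close> in \<open>psl2z\<close> is the class of the
  matrix product, and the additive group structure of \<open>psl2z \<times> psl2z\<close> is that
  of the direct product.
\<close>

instantiation psl2z :: group_add
begin

lift_definition zero_psl2z :: psl2z is "mat 1"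
  by (simp add: psl_eq_def)

lift_definition plus_psl2z :: "psl2z \<Rightarrow> psl2z \<Rightarrow> psl2z" is "(**)"
  by (rule psl_eq_mult)

lift_definition uminus_psl2z :: "psl2z \<Rightarrow> psl2z" is adj2
  by (rule psl_eq_adj2)

definition minus_psl2z :: "psl2z \<Rightarrow> psl2z \<Rightarrow> psl2z" where
  "minus_psl2z x y = x + (- y)"

instance
proof
  fix x y z :: psl2z
  show "x + y + z = x + (y + z)"
    by transfer (auto simp: psl_eq_def det_mul matrix_mul_assoc)
  show "0 + x = x"
    by transfer (auto simp: psl_eq_def)
  show "x + 0 = x"
    by transfer (auto simp: psl_eq_def)
  show "- x + x = 0"
    by transfer (auto simp: psl_eq_def adj2_mult)
  show "x + - y = x - y"
    by (simp add: minus_psl2z_def)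
qed

end

lift_definition psl_S :: psl2z is "vector [vector [0, -1], vector [1, 0]]"
  by (simp add: psl_eq_def det_2)

lift_definition psl_U :: psl2z is "vector [vector [0, 1], vector [-1, 1]]"
  by (simp add: psl_eq_def det_2)

lift_definition psl_T :: psl2z is "vector [vector [1, 1], vector [0, 1]]"
  by (simp add: psl_eq_def det_2)

type_synonym 'g group_ring = "'g \<Rightarrow>\<^sub>0 int"

abbreviation of_group :: "'g \<Rightarrow> 'g group_ring" where
  "of_group g \<equiv> Poly_Mapping.single g 1"

definition S :: "psl2z group_ring" where "S = of_group psl_S"
definition U :: "psl2z group_ring" where "U = of_group psl_U"
definition T :: "psl2z group_ring" where "T = of_group psl_T"

lemma T_eq: "T = U\<^sup>2 * S"
proof -
  have "psl_T = psl_U + psl_U + psl_S"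
    by transfer (simp add: psl_eq_def det_2 vec2_2_eq_iff matrix_matrix_mult_def sum_2)
  then show ?thesis
    by (simp add: T_def U_def S_def power2_eq_square mult_single)
qed

lemma US_eq: "U * S = of_group (abs_psl2z (vector [vector [1, 0], vector [1, 1]]))"
proof -
  have "psl_U + psl_S = abs_psl2z (vector [vector [1, 0], vector [1, 1]])"
    by (simp add: psl_U_def psl_S_def plus_psl2z.abs_eq psl_eq_def det_2)
      (rule arg_cong[of _ _ abs_psl2z],
        simp add: vec2_2_eq_iff matrix_matrix_mult_def sum_2)
  then show ?thesis
    by (simp add: U_def S_def mult_single)
qed

text \<open>The bilinear extension of \<open>(g, h) \<mapsto> (g, h)\<close> to \<open>\<int>[G] \<times> \<int>[H] \<rightarrow> \<int>[G \<times> H]\<close>.\<close>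

definition tensor :: "'g group_ring \<Rightarrow> 'h group_ring \<Rightarrow> ('g \<times> 'h) group_ring" where
  "tensor x y = (\<Sum>g\<in>Poly_Mapping.keys x. \<Sum>h\<in>Poly_Mapping.keys y.
     Poly_Mapping.single (g, h) (Poly_Mapping.lookup x g * Poly_Mapping.lookup y h))"

lemma tensor_of_group: "tensor (of_group g) (of_group h) = of_group (g, h)"
  by (simp add: tensor_def)

definition left_ideal :: "'a::ring_1 set \<Rightarrow> bool" where
  "left_ideal I \<longleftrightarrow> 0 \<in> I \<and> (\<forall>x\<in>I. \<forall>y\<in>I. x + y \<in> I) \<and> (\<forall>r. \<forall>x\<in>I. r * x \<in> I)"

text \<open>The left ideal generated by \<open>X\<close> is \<open>left_ideal hull X\<close>.\<close>

lemma left_ideal_hull: "left_ideal (left_ideal hull X)"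
  by (rule hull_in) (auto simp: left_ideal_def)

definition I_H :: "(psl2z \<times> psl2z) group_ring set" where
  "I_H = left_ideal hull {tensor (1 + S) 1, tensor (1 + U + U\<^sup>2) 1, tensor 1 (1 - T)}"

definition I_V :: "(psl2z \<times> psl2z) group_ring set" where
  "I_V = left_ideal hull {tensor 1 (1 + S), tensor 1 (1 + U + U\<^sup>2), tensor (1 - U * S) 1}"

definition I_D :: "(psl2z \<times> psl2z) group_ring set" where
  "I_D = left_ideal hull {tensor 1 1 + tensor S S, tensor 1 1 + tensor U U + tensor (U\<^sup>2) (U\<^sup>2)}"

end

(*
Write s1 = (S,1), s2 = (1,S), e = 1 + s1 s2, and J for the ideal generated by the five elements.
Modulo J the second generator of I_D is a left multiple of e, so I_D = Z[Gamma^2] e + J, and it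
suffices to treat x = y e in I_H. Modulo (1 + s1) this says that y (1 - s2) is a multiple of
1 - (1,T) modulo the Manin relations in the first factor. Substituting q = y - c (1,U)^2, this
becomes q (1 - s2) = c (1 - (1,U)^2), an element whose sums over the cosets of <S> and of <U> in
the second factor vanish. Since Gamma is the free product of <S> and <U>, their cosets form a tree
with the elements of Gamma as edges, so the element vanishes. Hence q and c are multiples of the
norms of <S> and <U>, y lies in the ideal of Manin relations in the two factors, and y e lies in J.
*)

theory Submission imports Defs begin

section \<open>Left ideals\<close>

lemma left_ideal_zero: "left_ideal I \<Longrightarrow> 0 \<in> I"
  and left_ideal_add: "left_ideal I \<Longrightarrow> x \<in> I \<Longrightarrow> y \<in> I \<Longrightarrow> x + y \<in> I"
  and left_ideal_mult: "left_ideal I \<Longrightarrow> x \<in> I \<Longrightarrow> r * x \<in> I"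
  by (auto simp: left_ideal_def)

lemma left_ideal_uminus: "left_ideal I \<Longrightarrow> x \<in> I \<Longrightarrow> - x \<in> I"
  using left_ideal_mult[of I x "- 1"] by simp

lemma left_ideal_diff: "left_ideal I \<Longrightarrow> x \<in> I \<Longrightarrow> y \<in> I \<Longrightarrow> x - y \<in> I"
  using left_ideal_add[of I x "- y"] left_ideal_uminus[of I y] by simp

lemma left_ideal_sum: "left_ideal I \<Longrightarrow> (\<And>i. i \<in> A \<Longrightarrow> f i \<in> I) \<Longrightarrow> sum f A \<in> I"
  by (induction A rule: infinite_finite_induct) (auto intro: left_ideal_zero left_ideal_add)

lemma left_ideal_diffD: "left_ideal I \<Longrightarrow> x - y \<in> I \<Longrightarrow> y \<in> I \<Longrightarrow> x \<in> I"
  using left_ideal_add[of I "x - y" y] by simp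

lemmas left_ideal_intros = left_ideal_add left_ideal_diff left_ideal_mult

text \<open>With \<open>hull_minimal\<close>, a claim about \<open>y * a\<close> for all
  \<open>y\<close> in a generated ideal reduces to the generators.\<close>

lemma left_ideal_preimage_mult:
  assumes "left_ideal I"
  shows "left_ideal {y. y * a \<in> I}"
  using assms by (auto simp: left_ideal_def distrib_right mult.assoc)

text \<open>The set is the sum of \<open>I\<close> and the principal left ideal of \<open>a\<close>;
  containment of a hull in it can again be checked on generators.\<close>

lemma left_ideal_plus_principal:
  assumes "left_ideal I"
  shows "left_ideal {x. \<exists>c. x - c * a \<in> I}"
  unfolding left_ideal_def mem_Collect_eq Ball_def
proof (intro conjI allI impI)
  show "\<exists>c. 0 - c * a \<in> I"
    using assms by (intro exI[of _ 0]) (simp add: left_ideal_zero)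
next
  fix x y
  assume "\<exists>c. x - c * a \<in> I" "\<exists>c. y - c * a \<in> I"
  then obtain c d where "x - c * a \<in> I" "y - d * a \<in> I" by blast
  then have "(x - c * a) + (y - d * a) \<in> I"
    by (intro left_ideal_add assms)
  then show "\<exists>c. x + y - c * a \<in> I"
    by (intro exI[of _ "c + d"]) (simp add: algebra_simps)
next
  fix r x
  assume "\<exists>c. x - c * a \<in> I"
  then obtain c where "x - c * a \<in> I" by blast
  then have "r * (x - c * a) \<in> I"
    by (intro left_ideal_mult assms)
  then show "\<exists>c. r * x - c * a \<in> I"
    by (intro exI[of _ "r * c"]) (simp add: algebra_simps)
qed

section \<open>Two commuting copies of the modular group in a ring\<close>

text \<open>The parameters model (S,1), (1,S), (U,1), (1,U). The identities with explicit cofactors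
  follow from these word relations, so they are proved in an abstract ring.\<close>

locale modular_pair =
  fixes s1 s2 u1 u2 :: "'a::ring_1"
  assumes s1_s1: "s1 * s1 = 1" and s2_s2: "s2 * s2 = 1"
    and u1_u1_u1: "u1 * (u1 * u1) = 1" and u2_u2_u2: "u2 * (u2 * u2) = 1"
    and s2_s1: "s2 * s1 = s1 * s2" and s2_u1: "s2 * u1 = u1 * s2"
    and u2_s1: "u2 * s1 = s1 * u2" and u2_u1: "u2 * u1 = u1 * u2"
begin

text \<open>The relations with an arbitrary tail \<open>x\<close>: once products associate to the
  right, they move letters of the first factor to the left and reduce powers, giving a normal form
  for words.\<close>

lemma cancel:
  "s1 * (s1 * x) = x" "s2 * (s2 * x) = x" "u1 * (u1 * (u1 * x)) = x" "u2 * (u2 * (u2 * x)) = x"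
  "s2 * (s1 * x) = s1 * (s2 * x)" "s2 * (u1 * x) = u1 * (s2 * x)"
  "u2 * (s1 * x) = s1 * (u2 * x)" "u2 * (u1 * x) = u1 * (u2 * x)"
  using s1_s1 s2_s2 u1_u1_u1 u2_u2_u2 s2_s1 s2_u1 u2_s1 u2_u1
  by (simp_all flip: mult.assoc)

lemmas word_simps = s1_s1 s2_s2 u1_u1_u1 u2_u2_u2 s2_s1 s2_u1 u2_s1 u2_u1 cancel
  mult.assoc power2_eq_square algebra_simps

definition "horizontal = left_ideal hull {1 + s1, 1 + u1 + u1\<^sup>2, 1 - u2\<^sup>2 * s2}"
definition "vertical = left_ideal hull {1 + s2, 1 + u2 + u2\<^sup>2, 1 - u1 * s1}"
definition "diagonal = left_ideal hull {1 + s1 * s2, 1 + u1 * u2 + u1\<^sup>2 * u2\<^sup>2}"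
definition "five = s1 * s2 + s1 * (u2 * s2) + (u1 * s1) * (u2 * s2) + u2 - u1\<^sup>2 * u2\<^sup>2"
definition "cycles = left_ideal hull {(1 + s1) * (1 + s2),
  (1 + u1 + u1\<^sup>2) * (1 + s1 * s2), (1 + u2 + u2\<^sup>2) * (1 + s1 * s2),
  (1 + u1 + u1\<^sup>2) * (1 + u2 + u2\<^sup>2), five}"

lemma left_ideals:
  "left_ideal horizontal" "left_ideal vertical" "left_ideal diagonal" "left_ideal cycles"
  by (simp_all add: horizontal_def vertical_def diagonal_def cycles_def left_ideal_hull)

lemma horizontal_gens: "1 + s1 \<in> horizontal" "1 + u1 + u1\<^sup>2 \<in> horizontal" "1 - u2\<^sup>2 * s2 \<in> horizontal"
  and vertical_gens: "1 + s2 \<in> vertical" "1 + u2 + u2\<^sup>2 \<in> vertical" "1 - u1 * s1 \<in> vertical"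
  and diagonal_gens: "1 + s1 * s2 \<in> diagonal" "1 + u1 * u2 + u1\<^sup>2 * u2\<^sup>2 \<in> diagonal"
  and cycles_gens: "(1 + s1) * (1 + s2) \<in> cycles"
    "(1 + u1 + u1\<^sup>2) * (1 + s1 * s2) \<in> cycles" "(1 + u2 + u2\<^sup>2) * (1 + s1 * s2) \<in> cycles"
    "(1 + u1 + u1\<^sup>2) * (1 + u2 + u2\<^sup>2) \<in> cycles" "five \<in> cycles"
  by (simp_all add: horizontal_def vertical_def diagonal_def cycles_def hull_inc)

section \<open>The five generators lie in each of the three ideals\<close>

lemma cycles_subset_horizontal: "cycles \<subseteq> horizontal"
proof -
  note intros = left_ideal_intros[OF left_ideals(1)] horizontal_gens
  have "(1 + s1) * (1 + s2) \<in> horizontal"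
  proof -
    have "(1 + s1) * (1 + s2)
        = (1 + s2) * (1 + s1)"
      by (simp add: word_simps)
    also have "\<dots> \<in> horizontal"
      by (intro intros)
    finally show ?thesis .
  qed
  moreover have "(1 + u1 + u1\<^sup>2) * (1 + s1 * s2) \<in> horizontal"
  proof -
    have "(1 + u1 + u1\<^sup>2) * (1 + s1 * s2)
        = (1 + u1 + u1\<^sup>2) + ((1 + u1 + u1\<^sup>2) * s2) * (1 + s1) - s2 * (1 + u1 + u1\<^sup>2)"
      by (simp add: word_simps)
    also have "\<dots> \<in> horizontal"
      by (intro intros)
    finally show ?thesis .
  qed
  moreover have "(1 + u2 + u2\<^sup>2) * (1 + s1 * s2) \<in> horizontal"
  proof -
    have "(1 + u2 + u2\<^sup>2) * (1 + s1 * s2)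
        = (1 + u2 + u2\<^sup>2) * (1 - u2\<^sup>2 * s2) + ((1 + u2 + u2\<^sup>2) * s2) * (1 + s1)"
      by (simp add: word_simps)
    also have "\<dots> \<in> horizontal"
      by (intro intros)
    finally show ?thesis .
  qed
  moreover have "(1 + u1 + u1\<^sup>2) * (1 + u2 + u2\<^sup>2) \<in> horizontal"
  proof -
    have "(1 + u1 + u1\<^sup>2) * (1 + u2 + u2\<^sup>2)
        = (1 + u2 + u2\<^sup>2) * (1 + u1 + u1\<^sup>2)"
      by (simp add: word_simps)
    also have "\<dots> \<in> horizontal"
      by (intro intros)
    finally show ?thesis .
  qed
  moreover have "five \<in> horizontal"
  proof -
    \<comment> \<open>Modulo the first and third generators of \<open>horizontal\<close>, a right
      factor \<open>s1\<close> may be replaced by -1 and a right factor \<open>s2\<close> by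
      \<open>u2\<close>, because \<open>u2\<close> has order 3. What remains is
      \<open>- u2\<^sup>2 * (1 + u1 + u1\<^sup>2)\<close>.\<close>
    have "five
        = (s2 + u2 * s2 + u1 * (u2 * s2)) * (1 + s1)
          + (u2 + u2\<^sup>2 + u1 * u2\<^sup>2) * (1 - u2\<^sup>2 * s2) - u2\<^sup>2 * (1 + u1 + u1\<^sup>2)"
      by (simp add: five_def word_simps)
    also have "\<dots> \<in> horizontal"
      by (intro intros)
    finally show ?thesis .
  qed
  ultimately show ?thesis
    unfolding cycles_def by (intro hull_minimal left_ideals) simp
qed

lemma cycles_subset_vertical: "cycles \<subseteq> vertical"
proof -
  note intros = left_ideal_intros[OF left_ideals(2)] vertical_gens
  have "(1 + s1) * (1 + s2) \<in> vertical"
    by (intro intros)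
  moreover have "(1 + u1 + u1\<^sup>2) * (1 + s1 * s2) \<in> vertical"
  proof -
    have "(1 + u1 + u1\<^sup>2) * (1 + s1 * s2)
        = (1 + u1 + u1\<^sup>2) * (1 - u1 * s1) + ((1 + u1 + u1\<^sup>2) * s1) * (1 + s2)"
      by (simp add: word_simps)
    also have "\<dots> \<in> vertical"
      by (intro intros)
    finally show ?thesis .
  qed
  moreover have "(1 + u2 + u2\<^sup>2) * (1 + s1 * s2) \<in> vertical"
  proof -
    have "(1 + u2 + u2\<^sup>2) * (1 + s1 * s2)
        = (1 + u2 + u2\<^sup>2) + ((1 + u2 + u2\<^sup>2) * s1) * (1 + s2) - s1 * (1 + u2 + u2\<^sup>2)"
      by (simp add: word_simps)
    also have "\<dots> \<in> vertical"
      by (intro intros)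
    finally show ?thesis .
  qed
  moreover have "(1 + u1 + u1\<^sup>2) * (1 + u2 + u2\<^sup>2) \<in> vertical"
    by (intro intros)
  moreover have "five \<in> vertical"
  proof -
    \<comment> \<open>Here a right factor \<open>s2\<close> becomes -1 and a right factor
      \<open>s1\<close> becomes \<open>u1\<^sup>2\<close>, which leaves
      \<open>- u1\<^sup>2 * (1 + u2 + u2\<^sup>2)\<close>.\<close>
    have "five
        = (s1 + s1 * u2 + (u1 * s1) * u2) * (1 + s2)
          + (u1\<^sup>2 + u1\<^sup>2 * u2 + u2) * (1 - u1 * s1) - u1\<^sup>2 * (1 + u2 + u2\<^sup>2)"
      by (simp add: five_def word_simps)
    also have "\<dots> \<in> vertical"
      by (intro intros)
    finally show ?thesis .
  qed
  ultimately show ?thesis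
    unfolding cycles_def by (intro hull_minimal left_ideals) simp
qed

text \<open>This explains the fifth generator: it is the difference between a multiple of the
  two-term diagonal relation and the three-term one. It is used both to place \<open>five\<close> in
  \<open>diagonal\<close> and to eliminate the three-term generator modulo
  \<open>cycles\<close>.\<close>

lemma diagonal_three_term:
  "1 + u1 * u2 + u1\<^sup>2 * u2\<^sup>2 = (1 + u2 + u1 * u2) * (1 + s1 * s2) - five"
  by (simp add: five_def word_simps)

lemma cycles_subset_diagonal: "cycles \<subseteq> diagonal"
proof -
  note intros = left_ideal_intros[OF left_ideals(3)] diagonal_gens
  have "(1 + s1) * (1 + s2) \<in> diagonal"
  proof -
    have "(1 + s1) * (1 + s2)
        = (1 + s1) * (1 + s1 * s2)"
      by (simp add: word_simps)
    also have "\<dots> \<in> diagonal"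
      by (intro intros)
    finally show ?thesis .
  qed
  moreover have "(1 + u1 + u1\<^sup>2) * (1 + s1 * s2) \<in> diagonal"
    by (intro intros)
  moreover have "(1 + u2 + u2\<^sup>2) * (1 + s1 * s2) \<in> diagonal"
    by (intro intros)
  moreover have "(1 + u1 + u1\<^sup>2) * (1 + u2 + u2\<^sup>2) \<in> diagonal"
  proof -
    have "(1 + u1 + u1\<^sup>2) * (1 + u2 + u2\<^sup>2)
        = (1 + u1 + u1\<^sup>2) * (1 + u1 * u2 + u1\<^sup>2 * u2\<^sup>2)"
      by (simp add: word_simps)
    also have "\<dots> \<in> diagonal"
      by (intro intros)
    finally show ?thesis .
  qed
  moreover have "five \<in> diagonal"
  proof -
    have "five
        = (1 + u2 + u1 * u2) * (1 + s1 * s2) - (1 + u1 * u2 + u1\<^sup>2 * u2\<^sup>2)"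
      by (simp add: diagonal_three_term)
    also have "\<dots> \<in> diagonal"
      by (intro intros)
    finally show ?thesis .
  qed
  ultimately show ?thesis
    unfolding cycles_def by (intro hull_minimal left_ideals) simp
qed

section \<open>Reduction to multiples of the two-term diagonal relation\<close>

lemma diagonal_eq_modulo_cycles:
  assumes "x \<in> diagonal"
  shows "\<exists>y. x - y * (1 + s1 * s2) \<in> cycles"
proof -
  have "\<exists>y. 1 + s1 * s2 - y * (1 + s1 * s2) \<in> cycles"
    by (rule exI[of _ 1]) (simp add: left_ideal_zero left_ideals)
  moreover have "\<exists>y. 1 + u1 * u2 + u1\<^sup>2 * u2\<^sup>2 - y * (1 + s1 * s2) \<in> cycles"
    by (rule exI[of _ "1 + u2 + u1 * u2"])
      (simp add: diagonal_three_term left_ideal_uminus left_ideals cycles_gens)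
  ultimately have "diagonal \<subseteq> {x. \<exists>y. x - y * (1 + s1 * s2) \<in> cycles}"
    unfolding diagonal_def
    by (intro hull_minimal left_ideal_plus_principal left_ideals) auto
  with assms show ?thesis by blast
qed

text \<open>The two-term and three-term Manin relations in both factors.\<close>

definition "symbol_relations = left_ideal hull {1 + s1, 1 + u1 + u1\<^sup>2, 1 + s2, 1 + u2 + u2\<^sup>2}"

text \<open>Right multiplication by \<open>1 + s1 * s2\<close> sends both two-term relations to the
  first generator of \<open>cycles\<close>, and the three-term relations to the second and
  third.\<close>

lemma symbol_relations_mult_in_cycles:
  assumes "y \<in> symbol_relations"
  shows "y * (1 + s1 * s2) \<in> cycles"
proof -
  have "(1 + s1) * (1 + s1 * s2) = (1 + s1) * (1 + s2)"
    "(1 + s2) * (1 + s1 * s2) = (1 + s1) * (1 + s2)"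
    by (simp_all add: word_simps)
  then have "symbol_relations \<subseteq> {y. y * (1 + s1 * s2) \<in> cycles}"
    unfolding symbol_relations_def
    by (intro hull_minimal left_ideal_preimage_mult left_ideals)
      (auto simp only: insert_iff empty_iff mem_Collect_eq intro!: cycles_gens)
  with assms show ?thesis by blast
qed

text \<open>Modulo \<open>1 + s1\<close>, a right factor \<open>s1\<close> acts as -1, so
  \<open>y * (1 + s1 * s2)\<close> becomes \<open>y * (1 - s2)\<close>; \<open>c\<close> is the
  coefficient of the generator coming from T.\<close>

lemma horizontal_multiple:
  assumes "y * (1 + s1 * s2) \<in> horizontal"
  shows "\<exists>c. y * (1 - s2) - c * (1 - u2\<^sup>2 * s2) \<in> left_ideal hull {1 + s1, 1 + u1 + u1\<^sup>2}"
    (is "\<exists>c. _ \<in> ?L")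
proof -
  have gens: "1 + s1 \<in> ?L" "1 + u1 + u1\<^sup>2 \<in> ?L"
    by (simp_all add: hull_inc)
  have "1 - u2\<^sup>2 * s2 \<in> {x. \<exists>c. x - c * (1 - u2\<^sup>2 * s2) \<in> ?L}"
    by (auto intro!: exI[of _ 1] left_ideal_zero left_ideal_hull)
  moreover have "x \<in> {x. \<exists>c. x - c * (1 - u2\<^sup>2 * s2) \<in> ?L}" if "x \<in> ?L" for x
    using that by (auto intro: exI[of _ 0])
  ultimately have "horizontal \<subseteq> {x. \<exists>c. x - c * (1 - u2\<^sup>2 * s2) \<in> ?L}"
    unfolding horizontal_def
    by (intro hull_minimal left_ideal_plus_principal left_ideal_hull) (use gens in blast)
  with assms obtain c where "y * (1 + s1 * s2) - c * (1 - u2\<^sup>2 * s2) \<in> ?L"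
    by blast
  then have "y * (1 + s1 * s2) - c * (1 - u2\<^sup>2 * s2) - (y * s2) * (1 + s1) \<in> ?L"
    by (rule left_ideal_diff[OF left_ideal_hull _ left_ideal_mult[OF left_ideal_hull gens(1)]])
  moreover have "y * (1 + s1 * s2) - c * (1 - u2\<^sup>2 * s2) - (y * s2) * (1 + s1)
      = y * (1 - s2) - c * (1 - u2\<^sup>2 * s2)"
    by (simp add: word_simps)
  ultimately show ?thesis by metis
qed

end

section \<open>Tensors and slices\<close>

text \<open>An integral group ring is the free abelian group on the group, so additive statements
  need checking only on group elements.\<close>

lemma group_ring_induct [case_names zero of_group diff]:
  fixes x :: "'g group_ring"
  assumes "P 0" "\<And>g. P (of_group g)" "\<And>x y. P x \<Longrightarrow> P y \<Longrightarrow> P (x - y)"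
  shows "P x"
  by (rule frag_induction[of x UNIV]) (auto intro: assms)

lemma lookup_tensor:
  "Poly_Mapping.lookup (tensor x y) (g, h) = Poly_Mapping.lookup x g * Poly_Mapping.lookup y h"
proof -
  have "Poly_Mapping.lookup (tensor x y) (g, h) =
      (\<Sum>g'\<in>Poly_Mapping.keys x. \<Sum>h'\<in>Poly_Mapping.keys y.
        if g' = g \<and> h' = h then Poly_Mapping.lookup x g' * Poly_Mapping.lookup y h' else 0)"
    by (simp add: tensor_def lookup_sum lookup_single when_def)
  also have "\<dots> = (\<Sum>g'\<in>Poly_Mapping.keys x. if g' = g then
      (\<Sum>h'\<in>Poly_Mapping.keys y. if h' = h then Poly_Mapping.lookup x g' * Poly_Mapping.lookup y h' else 0) else 0)"
    by (intro sum.cong refl) auto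
  also have "\<dots> = Poly_Mapping.lookup x g * Poly_Mapping.lookup y h"
    by (simp add: in_keys_iff)
  finally show ?thesis .
qed

lemma tensor_zero: "tensor 0 y = 0" "tensor x 0 = 0"
  and tensor_add: "tensor (x + x') y = tensor x y + tensor x' y"
    "tensor x (y + y') = tensor x y + tensor x y'"
  and tensor_diff: "tensor (x - x') y = tensor x y - tensor x' y"
    "tensor x (y - y') = tensor x y - tensor x y'"
  by (auto intro!: poly_mapping_eqI simp: lookup_tensor lookup_add lookup_minus algebra_simps)

lemma one_eq_of_group: "(1 :: 'g::zero group_ring) = of_group 0"
  by simp

lemma tensor_one: "tensor (1 :: 'g::zero group_ring) (1 :: 'h::zero group_ring) = 1"
  unfolding one_eq_of_group tensor_of_group by (simp add: zero_prod_def)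

text \<open>Both sides are additive in each of the four arguments, hence four nested inductions down
  to group elements.\<close>

lemma tensor_mult:
  fixes x x' :: "'g::monoid_add group_ring" and y y' :: "'h::monoid_add group_ring"
  shows "tensor x y * tensor x' y' = tensor (x * x') (y * y')"
proof (induction x rule: group_ring_induct)
  case (of_group g)
  show ?case
  proof (induction y rule: group_ring_induct)
    case (of_group h)
    show ?case
    proof (induction x' rule: group_ring_induct)
      case (of_group g')
      show ?case
        by (induction y' rule: group_ring_induct)
          (simp_all add: tensor_zero tensor_diff tensor_of_group mult_single algebra_simps)
    qed (simp_all add: tensor_zero tensor_diff algebra_simps)
  qed (simp_all add: tensor_zero tensor_diff algebra_simps)
qed (simp_all add: tensor_zero tensor_diff algebra_simps)

text \<open>The coefficient of \<open>h\<close> when the group ring of the product is read as formal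
  sums over the second group with coefficients in the group ring of the first.\<close>

lift_definition slice :: "('g \<times> 'h \<Rightarrow>\<^sub>0 'c::zero) \<Rightarrow> 'h \<Rightarrow> 'g \<Rightarrow>\<^sub>0 'c"
  is "\<lambda>f h g. f (g, h)"
proof -
  fix f :: "'g \<times> 'h \<Rightarrow> 'c" and h
  assume "finite {k. f k \<noteq> 0}"
  then show "finite {g. f (g, h) \<noteq> 0}"
    by (rule finite_subset[rotated, OF finite_imageI[of _ fst]]) force
qed

lemma lookup_slice: "Poly_Mapping.lookup (slice x h) g = Poly_Mapping.lookup x (g, h)"
  by transfer simp

lemma slice_zero: "slice 0 h = 0"
  by (auto intro!: poly_mapping_eqI simp: lookup_slice)

lemma slice_add: "slice (x + y) h = slice x h + slice y h"
  by (auto intro!: poly_mapping_eqI simp: lookup_slice lookup_add)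

lemma slice_diff: "slice (x - y :: 'g \<times> 'h \<Rightarrow>\<^sub>0 'c::ab_group_add) h = slice x h - slice y h"
  by (auto intro!: poly_mapping_eqI simp: lookup_slice lookup_minus)

lemma slice_sum: "slice (\<Sum>i\<in>A. f i) h = (\<Sum>i\<in>A. slice (f i) h)"
  by (induction A rule: infinite_finite_induct) (simp_all add: slice_zero slice_add)

lemma slice_of_group: "slice (of_group (g, k)) h = (if k = h then of_group g else 0)"
  by (auto intro!: poly_mapping_eqI simp: lookup_slice lookup_single when_def)

lemma slice_tensor_of_group: "slice (tensor x (of_group k)) h = (if k = h then x else 0)"
  by (auto intro!: poly_mapping_eqI simp: lookup_slice lookup_tensor lookup_single)

lemma slice_mult_of_group_right:
  fixes x :: "('g::monoid_add \<times> 'h::group_add) group_ring"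
  shows "slice (x * of_group (0, k)) h = slice x (h - k)"
proof (induction x rule: group_ring_induct)
  case (of_group gl)
  obtain g l where "gl = (g, l)" by (cases gl)
  then show ?case
    by (auto simp: mult_single slice_of_group eq_diff_eq)
qed (simp_all add: slice_zero slice_diff algebra_simps)

lemma slice_mult_of_group_left:
  fixes x :: "('g::monoid_add \<times> 'h::group_add) group_ring"
  shows "slice (of_group (g, k) * x) h = of_group g * slice x (- k + h)"
proof (induction x rule: group_ring_induct)
  case (of_group gl)
  obtain g' l where "gl = (g', l)" by (cases gl)
  moreover have "k + l = h \<longleftrightarrow> l = - k + h"
    by (metis add.assoc add_minus_cancel minus_add_cancel)
  ultimately show ?case
    by (auto simp: mult_single slice_of_group)
qed (simp_all add: slice_zero slice_diff algebra_simps)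

lemma finite_nonzero_slices: "finite {h. slice x h \<noteq> 0}"
proof (rule finite_subset)
  show "{h. slice x h \<noteq> 0} \<subseteq> snd ` Poly_Mapping.keys x"
  proof
    fix h assume "h \<in> {h. slice x h \<noteq> 0}"
    then obtain g where "Poly_Mapping.lookup (slice x h) g \<noteq> 0"
      by (metis mem_Collect_eq poly_mapping_eqI lookup_zero)
    then show "h \<in> snd ` Poly_Mapping.keys x"
      by (force simp: lookup_slice in_keys_iff)
  qed
qed simp

lemma sum_tensor_slices:
  fixes x :: "('g \<times> 'h) group_ring"
  shows "x = (\<Sum>h | slice x h \<noteq> 0. tensor (slice x h) (of_group h))"
proof (rule poly_mapping_eqI)
  fix gh :: "'g \<times> 'h"
  obtain g k where gh: "gh = (g, k)" by (cases gh)
  have "(\<Sum>h | slice x h \<noteq> 0. Poly_Mapping.lookup (slice x h) g * (if h = k then 1 else 0))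
      = (\<Sum>h | slice x h \<noteq> 0. if h = k then Poly_Mapping.lookup (slice x h) g else 0)"
    by (intro sum.cong) auto
  also have "\<dots> = Poly_Mapping.lookup (slice x k) g"
    by (simp add: finite_nonzero_slices)
  finally show "Poly_Mapping.lookup x gh
      = Poly_Mapping.lookup (\<Sum>h | slice x h \<noteq> 0. tensor (slice x h) (of_group h)) gh"
    by (simp only: gh lookup_sum lookup_tensor lookup_single lookup_slice when_def)
qed

text \<open>For a left ideal \<open>A\<close> this is the extension of \<open>A\<close> to the group
  ring of the product, in a form where membership is tested one slice at a time.\<close>

definition sliced :: "'g group_ring set \<Rightarrow> ('g \<times> 'h) group_ring set" where
  "sliced A = {x. \<forall>h. slice x h \<in> A}"

lemma slicedD: "x \<in> sliced A \<Longrightarrow> slice x h \<in> A"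
  by (simp add: sliced_def)

lemma left_ideal_sliced:
  fixes A :: "'g::monoid_add group_ring set"
  assumes "left_ideal A"
  shows "left_ideal (sliced A :: ('g \<times> 'h::group_add) group_ring set)"
proof -
  have "slice (r * x) h \<in> A" if "\<forall>h. slice x h \<in> A" for r x :: "('g \<times> 'h) group_ring" and h
    using that
  proof (induction r rule: group_ring_induct)
    case (of_group gk)
    obtain g k where "gk = (g, k)" by (cases gk)
    then show ?case
      using of_group assms by (simp add: slice_mult_of_group_left left_ideal_mult)
  qed (simp_all add: slice_zero slice_diff left_diff_distrib left_ideal_zero left_ideal_diff assms)
  then show ?thesis
    using assms by (simp add: left_ideal_def sliced_def slice_zero slice_add)
qed

text \<open>Right multiplication by the second group only permutes the slices, so it preserves
  congruences modulo \<open>sliced A\<close>.\<close>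

lemma sliced_mult_of_group_right:
  fixes x :: "('g::monoid_add \<times> 'h::group_add) group_ring"
  shows "x \<in> sliced A \<Longrightarrow> x * of_group (0, k) \<in> sliced A"
  by (simp add: sliced_def slice_mult_of_group_right)

text \<open>Every element is the sum of its slices tensored with group elements, which gives one
  inclusion. The other holds because the slicewise set is a left ideal containing the
  generators.\<close>

lemma sliced_hull:
  fixes X :: "'g::monoid_add group_ring set"
  shows "sliced (left_ideal hull X) = left_ideal hull ((\<lambda>a. tensor a (1 :: 'h::group_add group_ring)) ` X)"
    (is "_ = ?H")
proof
  have "tensor a (of_group k) \<in> ?H" if "a \<in> left_ideal hull X" for a k
    using that
  proof (rule hull_induct)
    fix a assume "a \<in> X"
    then have "tensor 1 (of_group k) * tensor a 1 \<in> ?H"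
      by (intro left_ideal_mult left_ideal_hull hull_inc) auto
    then show "tensor a (of_group k) \<in> ?H"
      by (simp only: tensor_mult mult_1_left mult_1_right)
  next
    have "tensor (r * a) (of_group k) \<in> ?H" if "tensor a (of_group k) \<in> ?H" for r a
    proof -
      have "tensor r 1 * tensor a (of_group k) \<in> ?H"
        by (intro left_ideal_mult left_ideal_hull that)
      then show ?thesis
        by (simp only: tensor_mult mult_1_left)
    qed
    then show "left_ideal {a. tensor a (of_group k) \<in> ?H}"
      by (auto simp: left_ideal_def tensor_zero tensor_add
          intro: left_ideal_zero left_ideal_add left_ideal_hull)
  qed
  then have "(\<Sum>h | slice x h \<noteq> 0. tensor (slice x h) (of_group h)) \<in> ?H"
    if "x \<in> sliced (left_ideal hull X)" for x
    using that by (intro left_ideal_sum left_ideal_hull) (simp add: slicedD)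
  then show "sliced (left_ideal hull X) \<subseteq> ?H"
    by (intro subsetI) (subst sum_tensor_slices)
next
  show "?H \<subseteq> sliced (left_ideal hull X)"
  proof (intro hull_minimal left_ideal_sliced left_ideal_hull subsetI)
    fix x assume "x \<in> (\<lambda>a. tensor a (1 :: 'h group_ring)) ` X"
    then show "x \<in> sliced (left_ideal hull X)"
      unfolding one_eq_of_group
      by (auto simp: sliced_def slice_tensor_of_group hull_inc left_ideal_zero left_ideal_hull
          simp del: single_one)
  qed
qed

text \<open>One coset of the finite subgroup \<open>G\<close> on which \<open>q\<close> is nonzero modulo \<open>A\<close> is cleared at a time.\<close>

lemma coset_invariant_multiple_of_norm:
  fixes q :: "('g::monoid_add \<times> 'h::group_add) group_ring"
  assumes A: "left_ideal A" and G: "finite G" "0 \<in> G" "\<And>k l. k \<in> G \<Longrightarrow> l \<in> G \<Longrightarrow> k + l \<in> G"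
    "\<And>k. k \<in> G \<Longrightarrow> - k \<in> G"
  assumes "\<And>h k. k \<in> G \<Longrightarrow> slice q (h + k) - slice q h \<in> A"
  shows "\<exists>c. q - c * (\<Sum>k\<in>G. of_group (0, k)) \<in> sliced A"
  using assms(6)
proof (induction "card {h. slice q h \<notin> A}" arbitrary: q rule: less_induct)
  case less
  let ?N = "\<Sum>k\<in>G. of_group (0 :: 'g, k)"
  have fin: "finite {h. slice q h \<notin> A}"
    by (rule finite_subset[OF _ finite_nonzero_slices[of q]]) (auto simp: left_ideal_zero[OF A])
  show ?case
  proof (cases "\<exists>h. slice q h \<notin> A")
    case False
    then have "q - 0 * ?N \<in> sliced A" by (simp add: sliced_def)
    then show ?thesis by blast
  next
    case True
    then obtain h where h: "slice q h \<notin> A" by blast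
    define c where "c = tensor (slice q h) (of_group h)"
    define q' where "q' = q - c * ?N"
    have coset: "h = l - k \<longleftrightarrow> k = - h + l" for k l
    proof
      assume "h = l - k"
      then have "l = h + k" by simp
      then show "k = - h + l" by simp
    next
      assume "k = - h + l"
      then have "h + k = l" by simp
      then show "h = l - k" by (simp add: eq_diff_eq)
    qed
    \<comment> \<open>The correction changes only the slices over the left coset
      \<open>h + G\<close>, all by the same amount; by invariance these slices of \<open>q\<close>
      agree with \<open>slice q h\<close> modulo \<open>A\<close>.\<close>
    have slice_q': "slice q' l = slice q l - (if - h + l \<in> G then slice q h else 0)" for l
      using G(1) by (simp add: q'_def c_def slice_diff sum_distrib_left slice_sum
          slice_mult_of_group_right slice_tensor_of_group coset)
    have "- h + (l + k) \<in> G \<longleftrightarrow> - h + l \<in> G" if "k \<in> G" for k l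
      using G(3)[of "- h + l" k] G(3)[of "- h + l + k" "- k"] G(4)[OF that] that
      by (auto simp: add.assoc simp del: add_uminus_conv_diff)
    then have inv: "slice q' (l + k) - slice q' l \<in> A" if "k \<in> G" for k l
      using less.prems[OF that, of l] that by (simp add: slice_q')
    have sub: "slice q' l \<in> A" if "slice q l \<in> A" for l
    proof (cases "- h + l \<in> G")
      case True
      have "slice q (h + (- h + l)) - slice q h \<in> A"
        using less.prems[OF True] .
      then show ?thesis
        using True by (simp add: slice_q')
    next
      case False
      with that show ?thesis by (simp add: slice_q')
    qed
    have "slice q' h \<in> A"
      using G(2) left_ideal_zero[OF A] by (simp add: slice_q')
    with h sub have "{h. slice q' h \<notin> A} \<subset> {h. slice q h \<notin> A}"
      by blast
    then obtain c' where "q' - c' * ?N \<in> sliced A"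
      using less.hyps[of q'] inv psubset_card_mono[OF fin] by blast
    then have "q - (c + c') * ?N \<in> sliced A"
      by (simp add: q'_def algebra_simps)
    then show ?thesis by blast
  qed
qed

section \<open>The tree of the modular group\<close>

text \<open>
  The columns of a matrix are the ends of an oriented edge of the Farey tessellation. The entry sum
  grows with the distance of the edge from the base edge, and the parity bit singles out the
  orientation for which the adjacent triangle points away from it.
\<close>

lift_definition height :: "psl2z \<Rightarrow> int" is
  "\<lambda>A. 2 * (\<bar>A$1$1\<bar> + \<bar>A$1$2\<bar> + \<bar>A$2$1\<bar> + \<bar>A$2$2\<bar>) +
    (if A$1$1 * A$1$2 \<ge> 0 \<and> A$2$1 * A$2$2 \<ge> 0 then 1 else 0)"
  by (auto simp: psl_eq_def)

text \<open>If no row has entries of opposite signs, passing to the other two edges of the triangle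
  adds absolute values, and the factor 2 outweighs the bit. Otherwise reversing the edge keeps the
  absolute values and turns the bit from 0 to 1.\<close>

lemma height_increases_aux:
  fixes a b c d :: int
  defines "H \<equiv> \<lambda>a b c d :: int. 2 * (\<bar>a\<bar> + \<bar>b\<bar> + \<bar>c\<bar> + \<bar>d\<bar>) + (if a * b \<ge> 0 \<and> c * d \<ge> 0 then 1 else 0)"
  assumes det: "a * d - b * c = 1"
  shows "H a b c d < H b (- a) d (- c) \<or>
    H a b c d < H (- b) (a + b) (- d) (c + d) \<and> H a b c d < H (- a - b) a (- c - d) c"
proof (cases "a * b \<ge> 0 \<and> c * d \<ge> 0")
  case True
  define A B C D where "A = \<bar>a\<bar>" and "B = \<bar>b\<bar>" and "C = \<bar>c\<bar>" and "D = \<bar>d\<bar>"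
  note abs_defs = A_def B_def C_def D_def
  have ab: "\<bar>a + b\<bar> = A + B" and cd: "\<bar>c + d\<bar> = C + D"
    using True by (auto simp: abs_defs zero_le_mult_iff)
  have ab': "\<bar>- a - b\<bar> = A + B" and cd': "\<bar>- c - d\<bar> = C + D"
    using ab cd abs_minus_cancel[of "a + b"] abs_minus_cancel[of "c + d"] by simp_all
  have lower: "2 * (\<bar>x\<bar> + \<bar>y\<bar> + \<bar>z\<bar> + \<bar>w\<bar>) \<le> H x y z w" for x y z w
    by (simp add: H_def)
  have eq: "H a b c d = 2 * (A + B + C + D) + 1"
    using True by (simp add: H_def abs_defs)
  \<comment> \<open>Neither column of a matrix of determinant 1 vanishes, so the entry sum grows by
    at least 1 and its double by at least 2.\<close>
  have "b \<noteq> 0 \<or> d \<noteq> 0" "a \<noteq> 0 \<or> c \<noteq> 0"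
    using det by auto
  then have "B + D > 0" "A + C > 0"
    by (auto simp: abs_defs intro: add_pos_nonneg add_nonneg_pos)
  then have pos: "2 * (A + B + C + D) + 2 \<le> 2 * (B + (A + B) + D + (C + D))"
    "2 * (A + B + C + D) + 2 \<le> 2 * ((A + B) + A + (C + D) + C)"
    by presburger+
  have "2 * (B + (A + B) + D + (C + D)) \<le> H (- b) (a + b) (- d) (c + d)"
    using lower[of "- b" "a + b" "- d" "c + d"] by (simp only: ab cd abs_minus_cancel flip: abs_defs)
  moreover have "2 * ((A + B) + A + (C + D) + C) \<le> H (- a - b) a (- c - d) c"
    using lower[of "- a - b" a "- c - d" c] by (simp only: ab' cd' flip: abs_defs)
  ultimately show ?thesis
    using eq pos by simp
next
  case False
  \<comment> \<open>Since \<open>a * d = b * c + 1\<close>, this is a product of consecutive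
    integers, hence nonnegative. So the row products cannot have strictly opposite signs.\<close>
  have "(a * b) * (c * d) = (b * c) * (b * c + 1)"
    using det by algebra
  moreover have "x * (x + 1) \<ge> 0" for x :: int
    by (cases "x \<ge> 0") (auto intro: mult_nonpos_nonpos)
  ultimately have "(a * b) * (c * d) \<ge> 0" by metis
  moreover have "a * b < 0 \<or> c * d < 0"
    using False by linarith
  moreover have "x \<le> 0 \<and> y \<le> 0" if "x * y \<ge> 0" "x < 0 \<or> y < 0" for x y :: int
    using that by (auto simp: zero_le_mult_iff)
  ultimately have "a * b \<le> 0 \<and> c * d \<le> 0"
    by blast
  then have "b * - a \<ge> 0 \<and> d * - c \<ge> 0"
    by (simp add: mult.commute)
  then have "H b (- a) d (- c) = 2 * (\<bar>b\<bar> + \<bar>a\<bar> + \<bar>d\<bar> + \<bar>c\<bar>) + 1"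
    unfolding H_def by (simp only: abs_minus_cancel if_True simp_thms)
  moreover have "H a b c d = 2 * (\<bar>a\<bar> + \<bar>b\<bar> + \<bar>c\<bar> + \<bar>d\<bar>)"
    unfolding H_def using False by (simp only: if_False add_0_right)
  ultimately show ?thesis
    by simp
qed

text \<open>Thus \<open>g\<close> is the strictly lowest member of its coset of the subgroup
  generated by \<open>psl_S\<close> or by \<open>psl_U\<close>: in the tree, the rest of that coset
  lies farther from the base edge.\<close>

lemma height_increases:
  "height g < height (g + psl_S) \<or>
    height g < height (g + psl_U) \<and> height g < height (g + psl_U + psl_U)"
proof (transfer, goal_cases)
  case (1 g)
  define a b c d where "a = g$1$1" and "b = g$1$2" and "c = g$2$1" and "d = g$2$2"
  have "a * d - b * c = 1"
    using 1 by (simp add: psl_eq_def det_2 a_def b_def c_def d_def)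
  from height_increases_aux[OF this] show ?case
    unfolding a_def b_def c_def d_def
    by (simp add: matrix_matrix_mult_def sum_2)
qed

lemma psl_S_order: "psl_S + psl_S = 0" "psl_S \<noteq> 0"
  and psl_U_order: "psl_U + (psl_U + psl_U) = 0" "psl_U \<noteq> 0" "psl_U + psl_U \<noteq> 0" "psl_U + psl_U \<noteq> psl_U"
  by (transfer; simp add: psl_eq_def det_2 vec2_2_eq_iff matrix_matrix_mult_def sum_2 mat_def)+

text \<open>
  An element of maximal height in the support would be alone in its coset of one of the two subgroups.
\<close>

lemma zero_coset_sums:
  fixes F :: "psl2z \<Rightarrow> 'b::ring_1"
  assumes A: "left_ideal A" and fin: "finite {h. F h \<notin> A}"
    and S: "\<And>h. F h + F (h + psl_S) \<in> A"
    and U: "\<And>h. F h + F (h + psl_U) + F (h + psl_U + psl_U) \<in> A"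
  shows "F h \<in> A"
proof (rule ccontr)
  assume "F h \<notin> A"
  then have "\<exists>g. F g \<notin> A \<and> (\<forall>k. F k \<notin> A \<longrightarrow> height k \<le> height g)"
    using Max_in[of "height ` {h. F h \<notin> A}"] Max_ge[of "height ` {h. F h \<notin> A}"] fin
    by (smt (verit) empty_iff finite_imageI imageE imageI mem_Collect_eq)
  then obtain g where g: "F g \<notin> A" and max: "\<And>k. height g < height k \<Longrightarrow> F k \<in> A"
    by (meson not_le)
  from height_increases[of g] show False
  proof
    assume "height g < height (g + psl_S)"
    then have "F (g + psl_S) \<in> A" by (rule max)
    then have "F g + F (g + psl_S) - F (g + psl_S) \<in> A"
      by (intro left_ideal_diff A S)
    with g show False by simp
  next
    assume "height g < height (g + psl_U) \<and> height g < height (g + psl_U + psl_U)"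
    then have "F (g + psl_U) \<in> A" "F (g + psl_U + psl_U) \<in> A" by (auto intro: max)
    then have "F g + F (g + psl_U) + F (g + psl_U + psl_U) - F (g + psl_U + psl_U) - F (g + psl_U) \<in> A"
      by (intro left_ideal_diff A U)
    with g show False by simp
  qed
qed

section \<open>Solving the horizontal relation modulo the first factor\<close>

lemma minus_psl_S: "- psl_S = psl_S"
  using psl_S_order(1) by (rule minus_unique)

lemma minus_psl_U: "- psl_U = psl_U + psl_U"
  using psl_U_order(1) by (rule minus_unique)

lemma minus_psl_UU: "- (psl_U + psl_U) = psl_U"
  using psl_U_order(1) by (intro minus_unique) (simp add: add.assoc)

lemma diff_psl_S: "h - psl_S = h + psl_S"
  and diff_psl_U: "h - psl_U = h + psl_U + psl_U"
  and diff_psl_UU: "h - (psl_U + psl_U) = h + psl_U"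
  unfolding diff_conv_add_uminus minus_psl_S minus_psl_U minus_psl_UU by (simp_all add: add.assoc)

text \<open>In the application \<open>A\<close> consists of the Manin relations of the first factor,
  and \<open>u\<^sup>2 * s\<close> is (1,T). The conclusion says that \<open>y\<close> reduces to
  Manin relations of the second factor.\<close>

lemma symbol_kernel:
  fixes y c :: "('g::monoid_add \<times> psl2z) group_ring"
  defines "s \<equiv> of_group (0, psl_S)" and "u \<equiv> of_group (0, psl_U)"
  assumes A: "left_ideal A" and l: "y * (1 - s) - c * (1 - u\<^sup>2 * s) \<in> sliced A" (is "?l \<in> _")
  shows "\<exists>a b. y - a * (1 + s) - b * (1 + u + u\<^sup>2) \<in> sliced A"
proof -
  note intros = left_ideal_intros[OF left_ideal_sliced[OF A]]
  have uu: "u\<^sup>2 = of_group (0, psl_U + psl_U)"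
    by (simp add: u_def power2_eq_square mult_single)
  have uuu: "u * (u * u) = 1"
    by (simp add: u_def mult_single psl_U_order flip: zero_prod_def)
  then have uuu': "u * (u * (u * x)) = x" for x
    by (simp flip: mult.assoc)
  \<comment> \<open>This choice absorbs the term \<open>c * u\<^sup>2 * s\<close>: the element
    \<open>f = q * (1 - s)\<close> is annihilated by \<open>1 + s\<close> on the right, and it is
    congruent to \<open>c * (1 - u\<^sup>2)\<close>.\<close>
  define q where "q = y - c * u\<^sup>2"
  define f where "f = q - q * s"
  have f: "f = c - c * u\<^sup>2 + ?l"
    by (simp add: f_def q_def algebra_simps)
  have mult_u: "x * u \<in> sliced A" "x * u\<^sup>2 \<in> sliced A" if "x \<in> sliced A" for x
    using sliced_mult_of_group_right[OF that] by (simp_all add: uu) (simp add: u_def)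
  \<comment> \<open>As \<open>u\<close> has order 3,
    \<open>(1 - u\<^sup>2) * (1 + u + u\<^sup>2) = 0\<close>, and only the error term
    survives.\<close>
  have "f * (1 + u + u\<^sup>2) = ?l * (1 + u + u\<^sup>2)"
    unfolding f by (simp add: uuu uuu' power2_eq_square algebra_simps)
  also have "\<dots> = ?l + ?l * u + ?l * u\<^sup>2"
    by (simp add: distrib_left)
  also have "\<dots> \<in> sliced A"
    by (intro left_ideal_add[OF left_ideal_sliced[OF A]] mult_u l)
  finally have "f + f * u + f * u\<^sup>2 \<in> sliced A"
    by (simp add: distrib_left)
  then have "slice f h + slice f (h - psl_U) + slice f (h - (psl_U + psl_U)) \<in> A" for h
    unfolding uu using slicedD[of _ A h] by (fastforce simp: u_def slice_add slice_mult_of_group_right)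
  then have U: "slice f h + slice f (h + psl_U) + slice f (h + psl_U + psl_U) \<in> A" for h
    by (simp add: diff_psl_U diff_psl_UU add_ac)
  have slice_f: "slice f h = slice q h - slice q (h + psl_S)" for h
    by (simp add: f_def s_def slice_diff slice_mult_of_group_right diff_psl_S)
  have S: "slice f h + slice f (h + psl_S) \<in> A" for h
    by (simp add: slice_f add.assoc psl_S_order left_ideal_zero A)
  have "finite {h. slice f h \<notin> A}"
    by (rule finite_subset[OF _ finite_nonzero_slices[of f]]) (auto simp: left_ideal_zero[OF A])
  then have fA: "slice f h \<in> A" for h
    by (rule zero_coset_sums[OF A _ S U])
  \<comment> \<open>Vanishing of \<open>f\<close> modulo \<open>A\<close> means that the slices of
    \<open>q\<close> are constant along cosets of the order 2 subgroup, whose norm is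
    \<open>1 + s\<close>.\<close>
  have "slice q (h + k) - slice q h \<in> A" if "k \<in> {0, psl_S}" for h k
    using that left_ideal_uminus[OF A fA[of h]] by (auto simp: slice_f left_ideal_zero A)
  then have "\<exists>a. q - a * (\<Sum>k\<in>{0, psl_S}. of_group (0, k)) \<in> sliced A"
    by (intro coset_invariant_multiple_of_norm A) (auto simp: psl_S_order minus_psl_S)
  then obtain a where a: "q - a * (1 + s) \<in> sliced A"
    using psl_S_order by (auto simp: s_def simp flip: zero_prod_def)
  \<comment> \<open>The same vanishing, read through the other expression for \<open>f\<close>,
    makes the slices of \<open>c\<close> constant along cosets of the order 3 subgroup.\<close>
  have "f - ?l \<in> sliced A"
    by (rule left_ideal_diff[OF left_ideal_sliced[OF A] _ l]) (simp add: sliced_def fA)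
  then have "c - c * u\<^sup>2 \<in> sliced A"
    by (simp add: f)
  then have c1: "slice c h - slice c (h + psl_U) \<in> A" for h
    by (auto simp: uu slice_diff slice_mult_of_group_right diff_psl_UU dest: slicedD[of _ _ h])
  have "slice c (h + k) - slice c h \<in> A" if "k \<in> {0, psl_U, psl_U + psl_U}" for h k
    using that left_ideal_uminus[OF A c1[of h]]
      left_ideal_uminus[OF A left_ideal_add[OF A c1[of h] c1[of "h + psl_U"]]]
    by (auto simp: left_ideal_zero A add.assoc)
  \<comment> \<open>Needed for closure of the order 3 subgroup under addition: the square of U times
    itself is U.\<close>
  moreover have "psl_U + (psl_U + (psl_U + psl_U)) = psl_U"
    by (simp add: psl_U_order)
  ultimately have "\<exists>b. c - b * (\<Sum>k\<in>{0, psl_U, psl_U + psl_U}. of_group (0, k)) \<in> sliced A"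
    by (intro coset_invariant_multiple_of_norm A)
      (auto simp: psl_U_order minus_psl_U minus_psl_UU add.assoc)
  moreover have "(\<Sum>k\<in>{0, psl_U, psl_U + psl_U}. of_group (0, k)) = 1 + u + u\<^sup>2"
    unfolding uu using psl_U_order by (simp add: u_def add.assoc flip: zero_prod_def)
  ultimately obtain b where "c - b * (1 + u + u\<^sup>2) \<in> sliced A"
    by auto
  \<comment> \<open>To return to \<open>y = q + c * u\<^sup>2\<close>, multiply by
    \<open>u\<^sup>2\<close> on the right; the norm \<open>1 + u + u\<^sup>2\<close> is unchanged by
    this.\<close>
  then have "(c - b * (1 + u + u\<^sup>2)) * u\<^sup>2 \<in> sliced A"
    by (rule mult_u)
  with a have "(q - a * (1 + s)) + (c - b * (1 + u + u\<^sup>2)) * u\<^sup>2 \<in> sliced A"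
    by (rule intros)
  moreover have "(q - a * (1 + s)) + (c - b * (1 + u + u\<^sup>2)) * u\<^sup>2
      = y - a * (1 + s) - b * (1 + u + u\<^sup>2)"
    by (simp add: q_def uuu uuu' power2_eq_square algebra_simps)
  ultimately show ?thesis by metis
qed

section \<open>Intersection of the three ideals\<close>

lemma S_S: "S * S = 1" and U_U_U: "U * (U * U) = 1"
  by (simp_all add: S_def U_def mult_single psl_S_order psl_U_order)

global_interpretation pair: modular_pair "tensor S 1 :: (psl2z \<times> psl2z) group_ring"
  "tensor 1 S" "tensor U 1" "tensor 1 U"
  by standard (simp_all add: tensor_mult S_S U_U_U tensor_one)

lemma tensor_eq_mult: "tensor x y = tensor x 1 * tensor 1 y"
  for x :: "'g::monoid_add group_ring" and y :: "'h::monoid_add group_ring"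
  by (simp add: tensor_mult)

lemma tensor_square: "tensor (x\<^sup>2) 1 = (tensor x 1)\<^sup>2" "tensor 1 (y\<^sup>2) = (tensor 1 y)\<^sup>2"
  for x :: "'g::monoid_add group_ring" and y :: "'h::monoid_add group_ring"
  by (simp_all add: power2_eq_square tensor_mult)

lemma I_H_eq: "I_H = pair.horizontal"
  by (simp add: I_H_def pair.horizontal_def T_eq tensor_add tensor_diff tensor_one tensor_mult
      flip: tensor_square)

lemma I_V_eq: "I_V = pair.vertical"
  by (simp add: I_V_def pair.vertical_def tensor_add tensor_diff tensor_one tensor_mult
      flip: tensor_square)

lemma I_D_eq: "I_D = pair.diagonal"
  by (simp add: I_D_def pair.diagonal_def tensor_one tensor_mult flip: tensor_square)

text \<open>Joins the two halves: slices account for the Manin relations of the first factor, and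
  \<open>symbol_kernel\<close> produces those of the second.\<close>

lemma mult_in_I_H_imp:
  assumes "y * (1 + tensor S S) \<in> I_H"
  shows "y \<in> pair.symbol_relations"
proof -
  let ?A = "left_ideal hull {1 + S, 1 + U + U\<^sup>2}"
  have sliced_A: "(sliced ?A :: (psl2z \<times> psl2z) group_ring set)
      = left_ideal hull {1 + tensor S 1, 1 + tensor U 1 + (tensor U 1)\<^sup>2}"
    by (simp add: sliced_hull tensor_add tensor_one flip: tensor_square)
  have "y * (1 + tensor S 1 * tensor 1 S) \<in> pair.horizontal"
    using assms by (simp add: I_H_eq tensor_mult)
  from pair.horizontal_multiple[OF this] obtain c where
    "y * (1 - tensor 1 S) - c * (1 - (tensor 1 U)\<^sup>2 * tensor 1 S) \<in> sliced ?A"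
    unfolding sliced_A by blast
  moreover have "tensor 1 S = of_group (0, psl_S)" "tensor 1 U = of_group (0, psl_U)"
    by (simp_all add: S_def U_def one_eq_of_group tensor_of_group del: single_one)
  ultimately obtain a b where
    ab: "y - a * (1 + tensor 1 S) - b * (1 + tensor 1 U + (tensor 1 U)\<^sup>2) \<in> sliced ?A"
    using symbol_kernel[OF left_ideal_hull, of y c] by metis
  have ideal: "left_ideal pair.symbol_relations"
    by (simp add: pair.symbol_relations_def left_ideal_hull)
  have gens: "1 + tensor 1 S \<in> pair.symbol_relations"
    "1 + tensor 1 U + (tensor 1 U)\<^sup>2 \<in> pair.symbol_relations"
    by (simp_all add: pair.symbol_relations_def hull_inc)
  have "sliced ?A \<subseteq> pair.symbol_relations"
    unfolding sliced_A pair.symbol_relations_def by (rule hull_mono) auto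
  with ab have "y - a * (1 + tensor 1 S) - b * (1 + tensor 1 U + (tensor 1 U)\<^sup>2)
      \<in> pair.symbol_relations"
    by blast
  then have "y - a * (1 + tensor 1 S) \<in> pair.symbol_relations"
    by (rule left_ideal_diffD[OF ideal]) (intro left_ideal_mult ideal gens)
  then show ?thesis
    by (rule left_ideal_diffD[OF ideal]) (intro left_ideal_mult ideal gens)
qed

theorem mainTheorem5:
  "I_H \<inter> I_V \<inter> I_D = left_ideal hull
    {tensor (1 + S) (1 + S),
     tensor (1 + U + U\<^sup>2) 1 * (tensor 1 1 + tensor S S),
     tensor 1 (1 + U + U\<^sup>2) * (tensor 1 1 + tensor S S),
     tensor (1 + U + U\<^sup>2) (1 + U + U\<^sup>2),
     tensor S S + tensor S (U * S) + tensor (U * S) (U * S) + tensor 1 U - tensor (U\<^sup>2) (U\<^sup>2)}"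
    (is "_ = ?J")
proof -
  have J: "?J = pair.cycles"
    unfolding pair.cycles_def pair.five_def
      tensor_eq_mult[of "1 + S" "1 + S"] tensor_eq_mult[of "1 + U + U\<^sup>2" "1 + U + U\<^sup>2"]
    by (simp add: tensor_add tensor_one tensor_mult flip: tensor_square)
  have "x \<in> pair.cycles" if H: "x \<in> I_H" and D: "x \<in> I_D" for x
  proof -
    obtain y where y: "x - y * (1 + tensor S S) \<in> pair.cycles"
      using pair.diagonal_eq_modulo_cycles[of x] D by (auto simp: I_D_eq tensor_mult)
    with pair.cycles_subset_horizontal have "x - y * (1 + tensor S S) \<in> I_H"
      unfolding I_H_eq by blast
    with H have "x - (x - y * (1 + tensor S S)) \<in> I_H"
      unfolding I_H_eq by (rule left_ideal_diff[OF pair.left_ideals(1)])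
    then have "y \<in> pair.symbol_relations"
      by (intro mult_in_I_H_imp) simp
    then have "y * (1 + tensor S S) \<in> pair.cycles"
      using pair.symbol_relations_mult_in_cycles[of y] by (simp add: tensor_mult)
    with y have "(x - y * (1 + tensor S S)) + y * (1 + tensor S S) \<in> pair.cycles"
      by (intro left_ideal_add pair.left_ideals)
    then show ?thesis by simp
  qed
  moreover have "pair.cycles \<subseteq> I_H \<inter> I_V \<inter> I_D"
    unfolding I_H_eq I_V_eq I_D_eq
    using pair.cycles_subset_horizontal pair.cycles_subset_vertical pair.cycles_subset_diagonal
    by blast
  ultimately show ?thesis
    unfolding J by blast
qed

end
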